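(* Let $d\ge 1$ be an integer and let $f:[0,1]\to\mathbb{R}$ be a function such that (i) $f$ is continuous on $[0,1]$; (ii) $f(z)>0$ for all $z\in(0,1)$; (iii) the map $z\mapsto f(z)/z$ is strictly decreasing on $(0,1]$. Then there is no function $u\in C^2(\mathbb{R}^d)$ satisfying $$\Delta u+f(u)=0 \quad\text{and}\quad 0<u<1\quad\text{in } \mathbb{R}^d .$$
   Context: $\Delta$ denotes the Laplacian on $\mathbb{R}^d$, and $f(u)$ denotes the composition $x\mapsto f(u(x))$. Solutions are understood in the classical ($C^2$) sense. *)

theory Defs
  imports "HOL-Analysis.Analysis"
begin

text \<open>Partial derivative in the direction \<open>b\<close>; a junk value if
  \<open>has_pderiv b u x\<close> fails.\<close>

definition pderiv_at :: "'a::euclidean_space \<Rightarrow> ('a \<Rightarrow> real) \<Rightarrow> 'a \<Rightarrow> real"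
  where "pderiv_at b u x = deriv (\<lambda>t. u (x + t *\<^sub>R b)) 0"

definition has_pderiv :: "'a::euclidean_space \<Rightarrow> ('a \<Rightarrow> real) \<Rightarrow> 'a \<Rightarrow> bool"
  where "has_pderiv b u x \<longleftrightarrow> (\<lambda>t::real. u (x + t *\<^sub>R b)) differentiable (at 0)"

text \<open>The class $C^k$ on the whole space: all partial derivatives of order at most \<open>k\<close>,
  including the mixed ones, exist everywhere and are continuous.\<close>

primrec class_C :: "nat \<Rightarrow> ('a::euclidean_space \<Rightarrow> real) \<Rightarrow> bool"
  where
    "class_C 0 u \<longleftrightarrow> continuous_on UNIV u"
  | "class_C (Suc k) u \<longleftrightarrow> continuous_on UNIV u \<and>
       (\<forall>b\<in>Basis. (\<forall>x. has_pderiv b u x) \<and> class_C k (pderiv_at b u))"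

definition laplacian :: "('a::euclidean_space \<Rightarrow> real) \<Rightarrow> 'a \<Rightarrow> real"
  where "laplacian u x = (\<Sum>b\<in>Basis. pderiv_at b (pderiv_at b u) x)"

end

theory Submission
  imports Defs
begin

text \<open>Let \<open>c = f (u 0) / u 0 > 0\<close> and compare \<open>u\<close> with \<open>\<phi> x = (\<rho> - |x|\<^sup>2)\<^sup>2\<close> on the ball of radius
  \<open>sqrt \<rho>\<close>. At a maximum point \<open>y\<close> of \<open>\<phi> / u\<close>, with value \<open>M\<close>, one has \<open>u y \<le> u 0\<close>, because \<open>\<phi>\<close> is
  largest at the centre; monotonicity of \<open>f z / z\<close> then gives \<open>f (u y) \<ge> c * u y\<close>. Since \<open>M u - \<phi>\<close> has
  a local minimum at \<open>y\<close>, with \<open>s = \<rho> - |y|\<^sup>2\<close> and \<open>d\<close> the dimension,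
  \<open>c s\<^sup>2 \<le> M f (u y) = - M \<Delta>u y \<le> - \<Delta>\<phi> y = (4 d + 8) s - 8 \<rho>\<close>.
  For \<open>\<rho>\<close> large this quadratic inequality in \<open>s\<close> has no solution.\<close>

text \<open>If \<open>D < 0\<close>, then \<open>g'\<close> vanishes at \<open>a\<close> and is
  negative just to its right, so the mean value theorem puts values of \<open>g\<close> below
  \<open>g a\<close> arbitrarily close to \<open>a\<close>.\<close>

lemma second_deriv_nonneg_at_local_min:
  fixes g g' :: "real \<Rightarrow> real"
  assumes g: "\<And>t. (g has_real_derivative g' t) (at t)"
    and g': "(g' has_real_derivative D) (at a)"
    and e: "e > 0" and min: "\<And>t. \<bar>t - a\<bar> < e \<Longrightarrow> g a \<le> g t"
  shows "D \<ge> 0"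
proof (rule ccontr)
  assume "\<not> D \<ge> 0"
  then obtain d where d: "d > 0" "\<And>h. 0 < h \<Longrightarrow> h < d \<Longrightarrow> g' (a + h) < g' a"
    using DERIV_neg_dec_right[OF g'] by auto
  have "g' a = 0"
    using DERIV_local_min[OF g e] min by (simp add: abs_minus_commute)
  define h where "h = min d e / 2"
  have h: "0 < h" "h < d" "h < e"
    using d(1) e by (auto simp: h_def min_def)
  obtain z where z: "a < z" "z < a + h" "g (a + h) - g a = (a + h - a) * g' z"
    using MVT2[of a "a + h" g g'] g h(1) by auto
  have "g' z < 0"
    using d(2)[of "z - a"] z h \<open>g' a = 0\<close> by simp
  then have "g (a + h) < g a"
    using z h mult_pos_neg[of h "g' z"] by simp
  with min[of "a + h"] h show False by simp
qed

lemma has_pderiv_line: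
  assumes "\<And>x. has_pderiv b u x"
  shows "((\<lambda>t. u (x + t *\<^sub>R b)) has_real_derivative pderiv_at b u (x + t *\<^sub>R b)) (at t)"
proof -
  have "((\<lambda>h. u ((x + t *\<^sub>R b) + h *\<^sub>R b)) has_real_derivative pderiv_at b u (x + t *\<^sub>R b)) (at 0)"
    using assms[of "x + t *\<^sub>R b"] unfolding has_pderiv_def pderiv_at_def
    by (simp add: DERIV_deriv_iff_real_differentiable)
  then show ?thesis
    using DERIV_shift[of "\<lambda>t. u (x + t *\<^sub>R b)" "pderiv_at b u (x + t *\<^sub>R b)" 0 t]
    by (simp add: algebra_simps)
qed

lemma class_C_2D:
  assumes "class_C 2 u" "b \<in> Basis"
  shows "has_pderiv b u x" "has_pderiv b (pderiv_at b u) x"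
  using assms by (auto simp: numeral_2_eq_2)

text \<open>The left-hand side of the conclusion is the Laplacian of
  \<open>(\<rho> - (norm x)\<^sup>2)\<^sup>2\<close> at \<open>y\<close>. The one-dimensional test
  applies along each coordinate line through \<open>y\<close>, and the results are summed over
  \<open>Basis\<close>.\<close>

lemma laplacian_bound_at_touching_point:
  fixes u :: "'a::euclidean_space \<Rightarrow> real"
  assumes u: "class_C 2 u" and e: "e > 0"
    and le: "\<And>x. dist x y < e \<Longrightarrow>
      M * u y - (\<rho> - (norm y)\<^sup>2)\<^sup>2 \<le> M * u x - (\<rho> - (norm x)\<^sup>2)\<^sup>2"
  shows "8 * (norm y)\<^sup>2 - 4 * DIM('a) * (\<rho> - (norm y)\<^sup>2) \<le> M * laplacian u y"
proof -
  define s where "s = \<rho> - (norm y)\<^sup>2"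
  have "8 * (y \<bullet> b)\<^sup>2 - 4 * s \<le> M * pderiv_at b (pderiv_at b u) y" if b: "b \<in> Basis" for b
  proof -
    define a where "a = y \<bullet> b"
    \<comment> \<open>The bracket is \<open>\<rho> - (norm (y + t *\<^sub>R b))\<^sup>2\<close>
      expanded in \<open>t\<close>, so that the derivatives can be computed for a
      polynomial.\<close>
    define g where "g t = M * u (y + t *\<^sub>R b) - (s - 2 * a * t - t\<^sup>2)\<^sup>2" for t
    define g' where "g' t = M * pderiv_at b u (y + t *\<^sub>R b)
      - 2 * (s - 2 * a * t - t\<^sup>2) * (- 2 * a - 2 * t)" for t
    have "(g has_real_derivative g' t) (at t)" for t
      unfolding g_def g'_def
      by (rule derivative_eq_intros has_pderiv_line class_C_2D[OF u b] refl)+ simp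
    moreover have "(g' has_real_derivative
        M * pderiv_at b (pderiv_at b u) (y + 0 *\<^sub>R b) - (8 * a\<^sup>2 - 4 * s)) (at 0)"
      unfolding g'_def
      by (rule derivative_eq_intros has_pderiv_line class_C_2D[OF u b] refl)+
        (simp add: power2_eq_square)
    moreover have "g 0 \<le> g t" if "\<bar>t - 0\<bar> < e" for t
    proof -
      have "(norm (y + t *\<^sub>R b))\<^sup>2 = (norm y)\<^sup>2 + 2 * a * t + t\<^sup>2"
        unfolding power2_norm_eq_inner a_def using b
        by (simp add: inner_simps inner_commute[of b y] power2_eq_square algebra_simps)
      then have "s - 2 * a * t - t\<^sup>2 = \<rho> - (norm (y + t *\<^sub>R b))\<^sup>2"
        by (simp add: s_def)
      moreover have "dist (y + t *\<^sub>R b) y < e"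
        using that b by (simp add: dist_norm)
      ultimately show ?thesis
        using le[of "y + t *\<^sub>R b"] by (simp add: g_def) (simp add: s_def)
    qed
    ultimately have "0 \<le> M * pderiv_at b (pderiv_at b u) (y + 0 *\<^sub>R b) - (8 * a\<^sup>2 - 4 * s)"
      using second_deriv_nonneg_at_local_min e by blast
    then show ?thesis by (simp add: a_def)
  qed
  then have "(\<Sum>b\<in>Basis. 8 * (y \<bullet> b)\<^sup>2 - 4 * s) \<le> M * laplacian u y"
    unfolding laplacian_def sum_distrib_left by (rule sum_mono)
  moreover have "(\<Sum>b\<in>Basis. (y \<bullet> b)\<^sup>2) = (norm y)\<^sup>2"
    unfolding power2_norm_eq_inner euclidean_inner[of y y] by (simp add: power2_eq_square)
  ultimately show ?thesis
    by (simp add: sum_subtractf s_def mult.left_commute right_diff_distrib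
        flip: sum_distrib_left)
qed

text \<open>The second hypothesis says that the discriminant of
  \<open>c * s\<^sup>2 - K * s + 8 * \<rho>\<close> is negative; multiplying by \<open>4 * c\<close>
  completes the square.\<close>

lemma positive_quadratic:
  fixes c K \<rho> s :: real
  assumes "c > 0" "K\<^sup>2 < 32 * c * \<rho>"
  shows "K * s - 8 * \<rho> < c * s\<^sup>2"
proof -
  have "4 * c * (c * s\<^sup>2 - (K * s - 8 * \<rho>)) = (2 * c * s - K)\<^sup>2 + (32 * c * \<rho> - K\<^sup>2)"
    by (simp add: power2_eq_square algebra_simps)
  also have "\<dots> > 0" using assms by (simp add: add_nonneg_pos)
  finally show ?thesis using assms(1) by (simp add: zero_less_mult_iff)
qed

text \<open>This is the comparison argument with \<open>f\<close> replaced by a linear bound. The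
  bound is assumed only where \<open>u x \<le> u 0\<close>, the region where monotonicity of
  \<open>f z / z\<close> supplies it and where the touching point lies.\<close>

lemma no_positive_supersolution:
  fixes u :: "'a::euclidean_space \<Rightarrow> real"
  assumes u: "class_C 2 u" and pos: "\<And>x. 0 < u x" and c: "c > 0"
    and super: "\<And>x. u x \<le> u 0 \<Longrightarrow> laplacian u x \<le> - c * u x"
  shows False
proof -
  \<comment> \<open>\<open>K\<close> is the coefficient of \<open>s\<close> after substituting
    \<open>\<rho> - s\<close> for \<open>(norm y)\<^sup>2\<close> in the Laplacian bound; the
    summand 1 in \<open>\<rho>\<close> makes the discriminant strictly negative.\<close>
  define K where "K = 4 * real DIM('a) + 8"
  define \<rho> where "\<rho> = K\<^sup>2 / (32 * c) + 1"
  have \<rho>: "\<rho> > 0" "K\<^sup>2 < 32 * c * \<rho>"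
    using c by (simp_all add: \<rho>_def add_nonneg_pos distrib_left)
  define \<phi> where "\<phi> x = (\<rho> - (norm x)\<^sup>2)\<^sup>2" for x :: 'a
  define B where "B = cball (0::'a) (sqrt \<rho>)"
  have B: "x \<in> B \<longleftrightarrow> (norm x)\<^sup>2 \<le> \<rho>" for x
    using \<rho>(1) real_le_rsqrt[of "norm x" \<rho>] sqrt_ge_absD[of "norm x" \<rho>] by (auto simp: B_def)
  have cont: "continuous_on B u"
    using u by (auto simp: numeral_2_eq_2 intro: continuous_on_subset)
  have "continuous_on B (\<lambda>x. \<phi> x / u x)"
    unfolding \<phi>_def using pos by (intro continuous_intros cont) (auto simp: less_imp_neq[symmetric])
  then obtain y where y: "y \<in> B" "\<And>x. x \<in> B \<Longrightarrow> \<phi> x / u x \<le> \<phi> y / u y"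
    using continuous_attains_sup[of B "\<lambda>x. \<phi> x / u x"] \<rho>(1) by (auto simp: B_def)
  define M where "M = \<phi> y / u y"
  define s where "s = \<rho> - (norm y)\<^sup>2"
  have M0: "\<rho>\<^sup>2 / u 0 \<le> M"
    using y(2)[of 0] \<rho>(1) by (simp add: B M_def \<phi>_def)
  have "\<rho>\<^sup>2 / u 0 > 0" using \<rho>(1) pos[of 0] by simp
  with M0 have M: "M > 0" by linarith
  have My: "M * u y = s\<^sup>2" using pos[of y] by (simp add: M_def \<phi>_def s_def)
  \<comment> \<open>\<open>\<phi>\<close> vanishes on the boundary sphere, whereas the maximal ratio
    is positive, so \<open>y\<close> is interior.\<close>
  then have "s \<noteq> 0" using M pos[of y] by auto
  with y(1) have s: "0 < s" "s \<le> \<rho>" by (auto simp: B s_def)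
  have "M * u y \<le> \<rho>\<^sup>2" using My s by (simp add: power_mono)
  also have "\<dots> \<le> M * u 0" using M0 pos[of 0] by (simp add: field_simps)
  finally have "u y \<le> u 0" using M by simp
  have "norm y < sqrt \<rho>"
    using s(1) by (intro real_less_rsqrt) (simp add: s_def)
  \<comment> \<open>The distance from \<open>y\<close> to the boundary sphere: within it
    \<open>\<phi> x \<le> M * u x\<close> holds, with equality at \<open>y\<close>.\<close>
  define e where "e = sqrt \<rho> - norm y"
  have "8 * (norm y)\<^sup>2 - 4 * DIM('a) * s \<le> M * laplacian u y"
    unfolding s_def
  proof (rule laplacian_bound_at_touching_point[OF u])
    show "e > 0" using \<open>norm y < sqrt \<rho>\<close> by (simp add: e_def)
    fix x assume "dist x y < e"
    then have "x \<in> B"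
      using norm_triangle_ineq[of y "x - y"] by (simp add: B_def e_def dist_norm)
    then have "\<phi> x \<le> M * u x"
      using y(2)[of x] pos[of x] by (simp add: M_def field_simps)
    then show "M * u y - (\<rho> - (norm y)\<^sup>2)\<^sup>2 \<le> M * u x - (\<rho> - (norm x)\<^sup>2)\<^sup>2"
      using My by (simp add: \<phi>_def s_def)
  qed
  also have "\<dots> \<le> M * (- c * u y)"
    using super[OF \<open>u y \<le> u 0\<close>] M by (intro mult_left_mono) auto
  also have "\<dots> = - c * s\<^sup>2" using My by (simp add: algebra_simps)
  finally have "c * s\<^sup>2 \<le> K * s - 8 * \<rho>"
    by (simp add: s_def K_def algebra_simps)
  with positive_quadratic[OF c \<rho>(2), of s] show False by simp
qed

theorem theorem1:
  fixes f :: "real \<Rightarrow> real"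
  assumes "continuous_on {0..1} f"
    and "\<forall>z\<in>{0<..<1}. f z > 0"
    and "strict_antimono_on {0<..1} (\<lambda>z. f z / z)"
  shows "\<not> (\<exists>u :: real ^ 'd \<Rightarrow> real. class_C 2 u \<and>
           (\<forall>x. laplacian u x + f (u x) = 0) \<and> (\<forall>x. 0 < u x \<and> u x < 1))"
proof
  assume "\<exists>u :: real ^ 'd \<Rightarrow> real. class_C 2 u \<and>
           (\<forall>x. laplacian u x + f (u x) = 0) \<and> (\<forall>x. 0 < u x \<and> u x < 1)"
  then obtain u :: "real ^ 'd \<Rightarrow> real" where u: "class_C 2 u"
    and eq: "\<And>x. laplacian u x + f (u x) = 0" and bd: "\<And>x. 0 < u x" "\<And>x. u x < 1"
    by auto
  define c where "c = f (u 0) / u 0"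
  show False
  proof (rule no_positive_supersolution[OF u bd(1)])
    show "c > 0" using assms(2) bd by (simp add: c_def)
    fix x assume le: "u x \<le> u 0"
    have "c \<le> f (u x) / u x"
    \<comment> \<open>Strict monotonicity compares only distinct arguments, so equality is treated
      apart.\<close>
    proof (cases "u x = u 0")
      case False
      then show ?thesis
        using monotone_onD[OF assms(3), of "u x" "u 0"] le bd[of x] bd[of 0] by (simp add: c_def)
    qed (simp add: c_def)
    then show "laplacian u x \<le> - c * u x"
      using eq[of x] bd(1)[of x] by (simp add: field_simps)
  qed
qed

end
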